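(* Let $F$ be a field and let $f\in F[x]$ be a decomposable polynomial of degree $n$ with $f'\neq 0$. (i) Let $d\geq 2$ divide $n$. Then there are at most $(n-1)/(d-1)$ minimal decompositions $(g,h)$ of $f$ with $\deg(h)=d$. (ii) Let $q$ be the smallest prime divisor of $n$. Then there are at most $(n-1)/(q-1)$ minimal decompositions of $f$.
   Context: A decomposition of $f\in F[x]$ is a pair $(g,h)$ of polynomials in $F[x]$, both of degree at least two, with $f=g\circ h$. A polynomial is decomposable if it has a decomposition, and indecomposable otherwise. A polynomial is normal if it is monic and has zero constant term. A decomposition $(g,h)$ is minimal if $h$ is normal and indecomposable. *)

theory Defs
  imports "HOL-Computational_Algebra.Computational_Algebra"
begin

definition is_decomposition :: "'a::field poly \<Rightarrow> 'a poly \<times> 'a poly \<Rightarrow> bool" where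
  "is_decomposition f gh \<longleftrightarrow>
     degree (fst gh) \<ge> 2 \<and> degree (snd gh) \<ge> 2 \<and> f = pcompose (fst gh) (snd gh)"

definition decomposable :: "'a::field poly \<Rightarrow> bool" where
  "decomposable f \<longleftrightarrow> (\<exists>gh. is_decomposition f gh)"

definition normal_poly :: "'a::field poly \<Rightarrow> bool" where
  "normal_poly h \<longleftrightarrow> lead_coeff h = 1 \<and> coeff h 0 = 0"

definition minimal_decompositions :: "'a::field poly \<Rightarrow> ('a poly \<times> 'a poly) set" where
  "minimal_decompositions f =
     {(g, h). is_decomposition f (g, h) \<and> normal_poly h \<and> \<not> decomposable h}"

end

theory Submission
  imports Defs
begin

text \<open>
  Write \<open>\<Delta>p = p(y) - p(x)\<close>, a polynomial in \<open>y\<close> over \<open>F[x]\<close>, and \<open>\<phi>(p) = \<Delta>p / (y - x)\<close>,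
  of degree \<open>deg p - 1\<close> in \<open>y\<close>. If \<open>f = g \<circ> h\<close>, then \<open>\<Delta>h\<close> divides \<open>\<Delta>f\<close>, so \<open>\<phi>(h)\<close> divides
  \<open>\<phi>(f)\<close>. The point is that for two distinct normal indecomposable polynomials \<open>h1\<close> and \<open>h2\<close>
  of degree at least two, \<open>\<phi>(h1)\<close> and \<open>\<phi>(h2)\<close> are comaximal in \<open>F(x)[y]\<close>
  (\<open>divided_differences_comaximal\<close>). Hence the product of the \<open>\<phi>(h)\<close> over all right components \<open>h\<close>
  of minimal decompositions of \<open>f\<close> divides \<open>\<phi>(f)\<close>, and comparing degrees in \<open>y\<close> gives
  \<open>\<Sum> (deg h - 1) \<le> n - 1\<close>. Both bounds follow: in (i) every summand is \<open>d - 1\<close>, and in (ii)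
  every \<open>deg h\<close> is a divisor of \<open>n\<close> greater than one, hence at least \<open>q\<close>. A decomposition is
  counted by its right component because \<open>h\<close> determines \<open>g\<close>.

  Comaximality is a form of Lueroth's theorem (\<open>lueroth_two_polynomials\<close>): there is a polynomial
  \<open>u\<close> such that \<open>h1\<close> and \<open>h2\<close> are both polynomials in \<open>u\<close>, and \<open>\<Delta>u\<close> lies in the ideal \<open>J\<close> generated
  by \<open>\<Delta>h1\<close> and \<open>\<Delta>h2\<close> in \<open>F(x)[y]\<close>. If \<open>deg u\<close> were at least two, indecomposability would make
  \<open>h1\<close> and \<open>h2\<close> both equal to the normal associate of \<open>u\<close>. So \<open>u = c x\<close>, which puts \<open>y - x\<close> into
  \<open>J\<close>; dividing by \<open>y - x\<close> puts \<open>1\<close> into the ideal of \<open>\<phi>(h1)\<close> and \<open>\<phi>(h2)\<close>.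

  To find \<open>u\<close>, let \<open>A\<close> be the ring of all \<open>a\<close> in \<open>F[x]\<close> with \<open>\<Delta>a\<close> in \<open>J\<close>. It contains \<open>F\<close>, \<open>h1\<close>
  and \<open>h2\<close>, and a quotient of two of its elements that is a polynomial is again in \<open>A\<close>. The ideal
  \<open>J\<close> has a monic generator \<open>g\<close>, and Euclid's algorithm produces it with coefficients in the fraction
  field of \<open>A\<close>, since those of \<open>\<Delta>h1\<close> and \<open>\<Delta>h2\<close> lie in \<open>A\<close>. By Gauss's lemma these coefficients
  are also polynomials, hence elements of \<open>A\<close>. Take \<open>u = g(x, 0)\<close>. For \<open>a\<close> in \<open>A\<close>, setting
  \<open>y = 0\<close> in the divisibility of \<open>\<Delta>a\<close> by \<open>g\<close> shows that \<open>u\<close> divides \<open>a - a(0)\<close>; the quotient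
  is again in \<open>A\<close>, so by induction on the degree \<open>a\<close> is a polynomial in \<open>u\<close>.
\<close>

section \<open>Gauss's lemma for monic factors\<close>

lemma prime_factor_exists_field_poly:
  fixes D :: "'a::field poly"
  assumes "degree D > 0"
  shows "\<exists>p. prime_elem p \<and> p dvd D"
proof -
  have "D \<noteq> 0" using assms by auto
  obtain X where X: "prod_mset X = smult (inverse (lead_coeff D)) D" "\<And>p. p \<in># X \<Longrightarrow> prime_elem p"
    using field_poly_prod_mset_prime_factorization[OF \<open>D \<noteq> 0\<close>]
      field_poly_in_prime_factorization_imp_prime by blast
  have "X \<noteq> {#}"
  proof
    assume "X = {#}"
    with X(1) have "degree (smult (inverse (lead_coeff D)) D) = 0" by (metis degree_1 prod_mset_empty)
    thus False using assms \<open>D \<noteq> 0\<close> by simp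
  qed
  then obtain p where p: "p \<in># X" by blast
  hence "p dvd smult (inverse (lead_coeff D)) D" using X(1) dvd_prod_mset by metis
  hence "p dvd D" using \<open>D \<noteq> 0\<close> by (simp add: dvd_smult_iff)
  thus ?thesis using X(2) p by blast
qed

lemma fract_poly_common_denominator:
  fixes g :: "'a::idom fract poly"
  shows "\<exists>D M. D \<noteq> 0 \<and> smult (to_fract D) g = fract_poly M"
proof (induction g)
  case 0
  have "smult (to_fract 1) (0 :: 'a fract poly) = fract_poly 0" by simp
  thus ?case by (metis one_neq_zero)
next
  case (pCons c g)
  then obtain D M where DM: "D \<noteq> 0" "smult (to_fract D) g = fract_poly M" by blast
  obtain a b where ab: "c = Fract a b" "b \<noteq> 0" by (cases c)
  have "to_fract (b * D) * c = to_fract (a * D)"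
    using ab by (simp add: Fract_conv_to_fract field_simps)
  moreover have "smult (to_fract (b * D)) g = fract_poly (smult b M)"
    using DM(2) by (metis fract_poly_smult smult_smult to_fract_mult)
  ultimately have "smult (to_fract (b * D)) (pCons c g) = fract_poly (pCons (a * D) (smult b M))"
    by (simp add: map_poly_pCons del: to_fract_mult)
  moreover have "b * D \<noteq> 0" using ab DM by simp
  ultimately show ?case by blast
qed

lemma smult_left_cancel:
  fixes c :: "'a::idom"
  assumes "c \<noteq> 0" "smult c p = smult c q"
  shows "p = q"
  using assms by (auto simp: poly_eq_iff)

text \<open>
  The usual descent in Gauss's lemma: as long as \<open>D\<close> is not constant, a prime factor \<open>p\<close> of \<open>D\<close>
  divides \<open>M * N\<close> and therefore one of the two factors, and it can be cancelled there. If it divides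
  \<open>N\<close>, it divides the leading coefficient of \<open>N\<close>, which is \<open>E\<close> because \<open>q\<close> is monic.
\<close>

lemma monic_factor_cleared_denominators:
  fixes f M N :: "'a::field poly poly" and g q :: "'a poly fract poly"
  assumes "g * q = fract_poly f" "lead_coeff g = 1" "lead_coeff q = 1"
    and "D \<noteq> 0" "E \<noteq> 0" "smult (to_fract D) g = fract_poly M" "smult (to_fract E) q = fract_poly N"
  shows "\<exists>G. g = fract_poly G"
  using assms(4-)
proof (induction "degree D + degree E" arbitrary: D E M N rule: less_induct)
  case less
  show ?case
  proof (cases "degree D = 0")
    case True
    then obtain c where c: "D = [:c:]" by (rule degree_eq_zeroE)
    with less.prems(1) have "c \<noteq> 0" by auto
    have "g = smult (to_fract [:inverse c:]) (smult (to_fract D) g)"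
      using \<open>c \<noteq> 0\<close> by (simp add: c flip: to_fract_mult) (simp flip: one_pCons)
    also have "\<dots> = fract_poly (smult [:inverse c:] M)" using less.prems by simp
    finally show ?thesis by blast
  next
    case False
    then obtain p where p: "prime_elem p" "p dvd D" using prime_factor_exists_field_poly by blast
    then obtain D' where D': "D = p * D'" by (elim dvdE)
    have p0: "p \<noteq> 0" and pdeg: "degree p > 0"
      using p(1) by (auto simp: prime_elem_def is_unit_iff_degree)
    have "fract_poly (M * N) = smult (to_fract (D * E)) (g * q)"
      using less.prems(3,4) by (simp add: mult_ac flip: less.prems(3,4))
    also have "\<dots> = fract_poly (smult (D * E) f)" using assms(1) by simp
    finally have "M * N = smult (D * E) f" by (simp only: fract_poly_eq_iff)
    hence "M * N = [:p:] * smult (D' * E) f" by (simp add: D' mult_ac)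
    hence "[:p:] dvd M * N" by (rule dvdI)
    hence "[:p:] dvd M \<or> [:p:] dvd N"
      using prime_elem_dvd_mult_iff lift_prime_elem_poly[OF p(1)] by blast
    thus ?thesis
    proof
      assume "[:p:] dvd M"
      then obtain M' where M': "M = [:p:] * M'" by (elim dvdE)
      have "smult (to_fract p) (smult (to_fract D') g) = smult (to_fract p) (fract_poly M')"
        using less.prems(3) by (simp add: D' M')
      hence 1: "smult (to_fract D') g = fract_poly M'" by (rule smult_left_cancel[rotated]) (use p0 in simp)
      have "D' \<noteq> 0" using less.prems(1) D' by auto
      moreover have "degree D' < degree D" using \<open>D' \<noteq> 0\<close> p0 pdeg by (simp add: D' degree_mult_eq)
      ultimately show ?thesis
        using less.hyps[of D' E M' N] 1 less.prems by simp
    next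
      assume "[:p:] dvd N"
      then obtain N' where N': "N = [:p:] * N'" by (elim dvdE)
      have "to_fract E = coeff (smult (to_fract E) q) (degree q)" using assms(3) by simp
      also have "\<dots> = to_fract (coeff N (degree q))" by (simp add: less.prems(4) coeff_map_poly)
      finally have "E = coeff N (degree q)" by simp
      hence E': "E = p * coeff N' (degree q)" by (simp add: N')
      define E' where "E' = coeff N' (degree q)"
      have "smult (to_fract p) (smult (to_fract E') q) = smult (to_fract p) (fract_poly N')"
        using less.prems(4) by (simp add: E' E'_def[symmetric] N')
      hence 1: "smult (to_fract E') q = fract_poly N'" by (rule smult_left_cancel[rotated]) (use p0 in simp)
      have "E' \<noteq> 0" using less.prems(2) E' E'_def by auto
      moreover have "degree E' < degree E"
        using \<open>E' \<noteq> 0\<close> p0 pdeg by (simp add: E' E'_def[symmetric] degree_mult_eq)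
      ultimately show ?thesis
        using less.hyps[of D E' M N'] 1 less.prems by simp
    qed
  qed
qed

lemma degree_fract_poly [simp]: "degree (fract_poly p) = degree p"
  by (rule degree_map_poly) simp

lemma lead_coeff_fract_poly: "lead_coeff (fract_poly p) = to_fract (lead_coeff p)"
  by (simp add: coeff_map_poly)

lemma monic_factor_fract_poly:
  fixes f :: "'a::field poly poly" and g :: "'a poly fract poly"
  assumes "g dvd fract_poly f" "lead_coeff f = 1" "lead_coeff g = 1"
  shows "\<exists>G. g = fract_poly G \<and> lead_coeff G = 1"
proof -
  obtain q where q: "g * q = fract_poly f" using assms(1) by (metis dvdE)
  have "lead_coeff (g * q) = 1" using assms(2) by (simp only: q lead_coeff_fract_poly) simp
  hence "lead_coeff q = 1" using assms(3) by (simp add: lead_coeff_mult)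
  then obtain G where G: "g = fract_poly G"
    using monic_factor_cleared_denominators[OF q assms(3)]
      fract_poly_common_denominator[of g] fract_poly_common_denominator[of q] by blast
  hence "to_fract (lead_coeff G) = to_fract 1"
    using assms(3) lead_coeff_fract_poly[of G] by (simp del: to_fract_eq_iff)
  thus ?thesis using G by (simp only: to_fract_eq_iff) blast
qed

text \<open>
  Division with remainder by a monic polynomial does not leave the base ring, and the remainder is
  too small to be divisible by \<open>G\<close> over the fraction field unless it vanishes.
\<close>

lemma monic_fract_poly_dvdD:
  fixes G H :: "'a::idom poly"
  assumes "lead_coeff G = 1" "fract_poly G dvd fract_poly H"
  shows "G dvd H"
proof -
  obtain q r where qr: "pseudo_divmod H G = (q, r)" by (cases "pseudo_divmod H G")
  have "G \<noteq> 0" using assms(1) by auto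
  have eq: "H = G * q + r" and small: "r = 0 \<or> degree r < degree G"
    using pseudo_divmod[OF \<open>G \<noteq> 0\<close> qr] assms(1) by simp_all
  have "fract_poly r = fract_poly H - fract_poly G * fract_poly q" by (simp add: eq)
  hence "fract_poly G dvd fract_poly r" using assms(2) by simp
  hence "r \<noteq> 0 \<Longrightarrow> degree (fract_poly G) \<le> degree (fract_poly r)" by (intro dvd_imp_degree_le) auto
  with small have "r = 0" by (metis degree_fract_poly not_less)
  thus ?thesis using eq by simp
qed

section \<open>The difference $p(y) - p(x)$ and its quotient by $y - x$\<close>

abbreviation lift_const :: "'a::comm_ring_1 poly \<Rightarrow> 'a poly poly" where
  "lift_const p \<equiv> map_poly (\<lambda>c. [:c:]) p"

text \<open>
  \<open>p(y) - p(x)\<close>, where \<open>y\<close> is the outer variable and \<open>x\<close> the variable of the coefficients.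
\<close>

definition Delta :: "'a::comm_ring_1 poly \<Rightarrow> 'a poly poly" where
  "Delta p = lift_const p - [:p:]"

lemma lift_const_diff: "lift_const (p - q) = lift_const p - lift_const q"
  by (rule poly_eqI) (simp add: coeff_map_poly)

lemma lift_const_add: "lift_const (p + q) = lift_const p + lift_const q"
  by (rule poly_eqI) (simp add: coeff_map_poly)

lemma lift_const_smult: "lift_const (smult c p) = smult [:c:] (lift_const p)"
  by (rule poly_eqI) (simp add: coeff_map_poly)

lemma lift_const_mult: "lift_const (p * q) = lift_const p * lift_const q"
proof (induction p)
  case (pCons a p)
  have "lift_const (pCons a p * q) = lift_const (smult a q) + lift_const (pCons 0 (p * q))"
    by (simp add: lift_const_add)
  also have "\<dots> = lift_const (pCons a p) * lift_const q"
    using pCons by (simp add: lift_const_smult map_poly_pCons)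
  finally show ?case .
qed simp

lemma Delta_diff: "Delta (p - q) = Delta p - Delta q"
  by (simp add: Delta_def lift_const_diff)

text \<open>
  The product rule \<open>p(y) q(y) - p(x) q(x) = q(y) (p(y) - p(x)) + p(x) (q(y) - q(x))\<close>. It makes the
  polynomials whose \<open>Delta\<close> lies in a given ideal a ring.
\<close>

lemma Delta_mult: "Delta (p * q) = lift_const q * Delta p + smult p (Delta q)"
  by (simp add: Delta_def lift_const_mult smult_diff_right algebra_simps)

lemma Delta_const [simp]: "Delta [:c:] = 0"
  by (simp add: Delta_def map_poly_pCons)

lemma Delta_0 [simp]: "Delta 0 = 0"
  using Delta_const[of 0] by simp

lemma coeff_Delta: "coeff (Delta p) i = [:coeff p i:] - (if i = 0 then p else 0)"
  by (cases i) (simp_all add: Delta_def coeff_map_poly)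

lemma degree_Delta [simp]: "degree (Delta p) = degree p"
proof (cases "degree p = 0")
  case True
  then show ?thesis by (auto elim!: degree_eq_zeroE)
next
  case False
  show ?thesis
  proof (rule antisym)
    show "degree (Delta p) \<le> degree p" by (rule degree_le) (auto simp: coeff_Delta coeff_eq_0)
    show "degree p \<le> degree (Delta p)" using False by (intro le_degree) (auto simp: coeff_Delta)
  qed
qed

lemma Delta_pcompose_dvd: "Delta h dvd Delta (g \<circ>\<^sub>p h)"
proof (induction g)
  case (pCons a g)
  have "Delta (pCons a g \<circ>\<^sub>p h) = Delta ([:a:] - (- h * (g \<circ>\<^sub>p h)))" by (simp add: pcompose_pCons)
  also have "\<dots> = - Delta (- h * (g \<circ>\<^sub>p h))" by (simp only: Delta_diff) simp
  also have "\<dots> = Delta (h * (g \<circ>\<^sub>p h))" using Delta_diff[of 0 "h * (g \<circ>\<^sub>p h)"] by simp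
  also have "Delta h dvd \<dots>" unfolding Delta_mult using pCons by (intro dvd_add dvd_smult) auto
  finally show ?case .
qed simp

text \<open>
  Synthetic division of \<open>p(y)\<close> by \<open>y - x\<close> leaves the remainder \<open>p(x)\<close>, so its quotient is
  \<open>(p(y) - p(x)) / (y - x)\<close>.
\<close>

definition divided_difference :: "'a::comm_ring_1 poly \<Rightarrow> 'a poly poly" where
  "divided_difference p = synthetic_div (lift_const p) [:0, 1:]"

lemma Delta_eq_divided_difference: "Delta p = [:-[:0, 1:], 1:] * divided_difference p"
proof -
  have "poly (lift_const p) [:0, 1:] = p" by (metis pcompose_altdef pcompose_idR)
  thus ?thesis using synthetic_div_correct'[of "[:0, 1:]" "lift_const p"]
    by (simp add: Delta_def divided_difference_def algebra_simps)
qed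

lemma degree_divided_difference: "degree (divided_difference p) = degree p - 1"
  by (simp add: divided_difference_def degree_synthetic_div degree_map_poly)

lemma divided_difference_pcompose_dvd:
  fixes g h :: "'a::idom poly"
  shows "divided_difference h dvd divided_difference (g \<circ>\<^sub>p h)"
  using Delta_pcompose_dvd[of h g] unfolding Delta_eq_divided_difference
  by (subst (asm) dvd_mult_cancel_left) simp

section \<open>Principal generators over a subfield of coefficients\<close>

text \<open>
  For a subfield \<open>K\<close> and a nonempty subset \<open>S\<close> of \<open>K[y]\<close> this is the ideal of \<open>K[y]\<close> generated by \<open>S\<close>, seen inside the polynomials over
  the large field. Closure under monomial multiples and differences suffices to generate it, and
  these are the operations used in one step of a polynomial division; so the coefficients are seen to
  stay in \<open>K\<close> by rule induction.
\<close>

inductive_set coeff_span :: "'b::field set \<Rightarrow> 'b poly set \<Rightarrow> 'b poly set"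
  for K :: "'b set" and S :: "'b poly set" where
  base: "p \<in> S \<Longrightarrow> p \<in> coeff_span K S"
| diff: "p \<in> coeff_span K S \<Longrightarrow> q \<in> coeff_span K S \<Longrightarrow> p - q \<in> coeff_span K S"
| monom: "c \<in> K \<Longrightarrow> p \<in> coeff_span K S \<Longrightarrow> monom c n * p \<in> coeff_span K S"

lemma coeff_span_coeff:
  assumes "p \<in> coeff_span K S" "\<And>p i. p \<in> S \<Longrightarrow> coeff p i \<in> K"
    and "\<And>a b. a \<in> K \<Longrightarrow> b \<in> K \<Longrightarrow> a - b \<in> K" "\<And>a b. a \<in> K \<Longrightarrow> b \<in> K \<Longrightarrow> a * b \<in> K"
  shows "coeff p i \<in> K"
  using assms(1)
proof (induction arbitrary: i)
  case (monom c p n)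
  hence "0 \<in> K" using assms(3)[of c c] by simp
  thus ?case using monom assms(4) by (simp add: coeff_monom_mult)
qed (use assms in auto)

text \<open>
  The ideals of \<open>K[y]\<close> are principal: a nonzero element of least degree can be made monic inside
  \<open>K[y]\<close>, and subtracting monomial multiples of it from any other element of the ideal ends in zero.
\<close>

lemma coeff_span_generator:
  assumes "p0 \<in> S" "p0 \<noteq> 0" "\<And>p i. p \<in> S \<Longrightarrow> coeff p i \<in> K"
    and K: "\<And>a b. a \<in> K \<Longrightarrow> b \<in> K \<Longrightarrow> a - b \<in> K" "\<And>a b. a \<in> K \<Longrightarrow> b \<in> K \<Longrightarrow> a * b \<in> K"
      "\<And>a. a \<in> K \<Longrightarrow> inverse a \<in> K"
  shows "\<exists>g\<in>coeff_span K S. lead_coeff g = 1 \<and> (\<forall>p\<in>coeff_span K S. g dvd p)"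
proof -
  let ?I = "coeff_span K S"
  have coeffs: "coeff p i \<in> K" if "p \<in> ?I" for p i
    using coeff_span_coeff[OF that assms(3) K(1,2)] .
  have "\<exists>m. m \<in> ?I \<and> m \<noteq> 0" using assms(1,2) coeff_span.base by blast
  then obtain m where m: "m \<in> ?I" "m \<noteq> 0" and least: "\<And>p. p \<in> ?I \<Longrightarrow> p \<noteq> 0 \<Longrightarrow> degree m \<le> degree p"
    using ex_has_least_nat[of "\<lambda>m. m \<in> ?I \<and> m \<noteq> 0" _ degree] by metis
  define g where "g = monom (inverse (lead_coeff m)) 0 * m"
  have g: "g \<in> ?I" unfolding g_def by (intro coeff_span.monom K(3) coeffs m(1))
  have g_smult: "g = smult (inverse (lead_coeff m)) m" by (simp add: g_def monom_0)
  have lg: "lead_coeff g = 1" and dg: "degree g = degree m" using m(2) by (simp_all add: g_smult)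
  have "g dvd p" if "p \<in> ?I" for p
    using that
  proof (induction "degree p" arbitrary: p rule: less_induct)
    case less
    show ?case
    proof (cases "p = 0")
      case False
      hence le: "degree g \<le> degree p" using least less.prems dg by simp
      let ?t = "monom (lead_coeff p) (degree p - degree g) * g"
      define p' where "p' = p - ?t"
      have p': "p' \<in> ?I" unfolding p'_def
        by (intro coeff_span.diff coeff_span.monom g less.prems coeffs)
      have "g \<noteq> 0" using lg by auto
      have dt: "degree ?t = degree p" using False le \<open>g \<noteq> 0\<close>
        by (subst degree_mult_eq) (auto simp: degree_monom_eq)
      have "coeff p' (degree p) = 0" using le lg by (simp add: p'_def coeff_monom_mult)
      moreover have "degree p' \<le> degree p" unfolding p'_def using dt by (intro degree_diff_le) auto
      ultimately have "p' = 0 \<or> degree p' < degree p"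
        by (metis le_neq_implies_less leading_coeff_0_iff)
      hence "g dvd p'" using less.hyps p' by auto
      hence "g dvd p' + ?t" by simp
      thus ?thesis by (simp add: p'_def)
    qed simp
  qed
  thus ?thesis using g lg by blast
qed

section \<open>Lueroth's theorem for two polynomials\<close>

definition ideal2 :: "'b::comm_ring_1 \<Rightarrow> 'b \<Rightarrow> 'b set" where
  "ideal2 P Q = {\<alpha> * P + \<beta> * Q |\<alpha> \<beta>. True}"

lemma ideal2_gens: "P \<in> ideal2 P Q" "Q \<in> ideal2 P Q"
proof -
  have "P = 1 * P + 0 * Q" "Q = 0 * P + 1 * Q" by simp_all
  thus "P \<in> ideal2 P Q" "Q \<in> ideal2 P Q" unfolding ideal2_def by blast+
qed

lemma ideal2_diff: "a \<in> ideal2 P Q \<Longrightarrow> b \<in> ideal2 P Q \<Longrightarrow> a - b \<in> ideal2 P Q"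
proof -
  assume "a \<in> ideal2 P Q" "b \<in> ideal2 P Q"
  then obtain \<alpha> \<beta> \<gamma> \<delta> where "a = \<alpha> * P + \<beta> * Q" "b = \<gamma> * P + \<delta> * Q" unfolding ideal2_def by blast
  hence "a - b = (\<alpha> - \<gamma>) * P + (\<beta> - \<delta>) * Q" by (simp add: algebra_simps)
  thus ?thesis unfolding ideal2_def by blast
qed

lemma ideal2_mult: "a \<in> ideal2 P Q \<Longrightarrow> r * a \<in> ideal2 P Q"
proof -
  assume "a \<in> ideal2 P Q"
  then obtain \<alpha> \<beta> where "a = \<alpha> * P + \<beta> * Q" unfolding ideal2_def by blast
  hence "r * a = (r * \<alpha>) * P + (r * \<beta>) * Q" by (simp add: algebra_simps)
  thus ?thesis unfolding ideal2_def by blast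
qed

lemma ideal2_add: "a \<in> ideal2 P Q \<Longrightarrow> b \<in> ideal2 P Q \<Longrightarrow> a + b \<in> ideal2 P Q"
  using ideal2_diff[of a P Q "(-1) * b"] ideal2_mult[of b P Q "-1"] by simp

lemma ideal2_smult:
  fixes P Q :: "'b::comm_ring_1 poly"
  shows "a \<in> ideal2 P Q \<Longrightarrow> smult c a \<in> ideal2 P Q"
  using ideal2_mult[of a P Q "[:c:]"] by simp

lemma ideal2_dvd: "a \<in> ideal2 P Q \<Longrightarrow> g dvd P \<Longrightarrow> g dvd Q \<Longrightarrow> g dvd a"
  unfolding ideal2_def by auto

text \<open>
  The polynomials that take the same value at the two points \<open>x\<close> and \<open>y\<close> modulo \<open>J\<close>.
\<close>

definition diagonal_ring :: "'a::field poly fract poly set \<Rightarrow> 'a poly set" where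
  "diagonal_ring J = {a. fract_poly (Delta a) \<in> J}"

lemma diagonal_ring_const: "[:c:] \<in> diagonal_ring (ideal2 P Q)"
  using ideal2_mult[OF ideal2_gens(1), of 0 P Q] by (simp add: diagonal_ring_def)

lemma diagonal_ring_diff:
  "a \<in> diagonal_ring (ideal2 P Q) \<Longrightarrow> b \<in> diagonal_ring (ideal2 P Q) \<Longrightarrow> a - b \<in> diagonal_ring (ideal2 P Q)"
  by (simp add: diagonal_ring_def Delta_diff ideal2_diff)

lemma diagonal_ring_mult:
  "a \<in> diagonal_ring (ideal2 P Q) \<Longrightarrow> b \<in> diagonal_ring (ideal2 P Q) \<Longrightarrow> a * b \<in> diagonal_ring (ideal2 P Q)"
  by (simp add: diagonal_ring_def Delta_mult ideal2_add ideal2_mult ideal2_smult)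

text \<open>
  Modulo the ideal, \<open>b(y) c(y) - b(x) c(x)\<close> and \<open>b(y) c(y) - b(x) c(y)\<close> vanish, so their difference
  \<open>b(x) (c(y) - c(x))\<close> does, and \<open>b(x)\<close> is invertible in \<open>F(x)\<close>. This is why the ring
  contains every polynomial in its fraction field.
\<close>

lemma diagonal_ring_cancel:
  assumes "b \<in> diagonal_ring (ideal2 P Q)" "b \<noteq> 0" "b * c \<in> diagonal_ring (ideal2 P Q)"
  shows "c \<in> diagonal_ring (ideal2 P Q)"
proof -
  let ?d = "\<lambda>p. fract_poly (Delta p)"
  have "?d (b * c) - fract_poly (lift_const c) * ?d b \<in> ideal2 P Q"
    using assms by (intro ideal2_diff ideal2_mult) (simp_all add: diagonal_ring_def)
  hence "smult (inverse (to_fract b)) (smult (to_fract b) (?d c)) \<in> ideal2 P Q"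
    by (intro ideal2_smult[of "smult _ _"]) (simp add: Delta_mult)
  thus ?thesis using assms(2) by (simp add: diagonal_ring_def)
qed

definition quotients :: "'a::idom set \<Rightarrow> 'a fract set" where
  "quotients A = {c. \<exists>a\<in>A. \<exists>b\<in>A. b \<noteq> 0 \<and> c = to_fract a / to_fract b}"

lemma quotients_base: "a \<in> A \<Longrightarrow> 1 \<in> A \<Longrightarrow> to_fract a \<in> quotients A"
  unfolding quotients_def by (intro CollectI bexI[of _ a] bexI[of _ 1]) auto

lemma quotients_mult:
  assumes "\<And>a b. a \<in> A \<Longrightarrow> b \<in> A \<Longrightarrow> a * b \<in> A" "x \<in> quotients A" "y \<in> quotients A"
  shows "x * y \<in> quotients A"
proof -
  obtain a b c d where *: "a \<in> A" "b \<in> A" "c \<in> A" "d \<in> A" "b \<noteq> 0" "d \<noteq> 0"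
    "x = to_fract a / to_fract b" "y = to_fract c / to_fract d"
    using assms unfolding quotients_def by blast
  hence "x * y = to_fract (a * c) / to_fract (b * d)" by simp
  moreover have "a * c \<in> A" "b * d \<in> A" "b * d \<noteq> 0" using * assms(1) by auto
  ultimately show ?thesis unfolding quotients_def by blast
qed

lemma quotients_diff:
  assumes "\<And>a b. a \<in> A \<Longrightarrow> b \<in> A \<Longrightarrow> a * b \<in> A" "\<And>a b. a \<in> A \<Longrightarrow> b \<in> A \<Longrightarrow> a - b \<in> A"
    "x \<in> quotients A" "y \<in> quotients A"
  shows "x - y \<in> quotients A"
proof -
  obtain a b c d where *: "a \<in> A" "b \<in> A" "c \<in> A" "d \<in> A" "b \<noteq> 0" "d \<noteq> 0"
    "x = to_fract a / to_fract b" "y = to_fract c / to_fract d"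
    using assms unfolding quotients_def by blast
  have "x - y = to_fract (a * d - c * b) / to_fract (b * d)"
    unfolding *(7,8) using *(5,6) by (simp add: diff_frac_eq)
  moreover have "a * d - c * b \<in> A" "b * d \<in> A" "b * d \<noteq> 0" using * assms(1,2) by auto
  ultimately show ?thesis unfolding quotients_def by blast
qed

lemma quotients_inverse:
  assumes "x \<in> quotients A"
  shows "inverse x \<in> quotients A"
proof (cases "x = 0")
  case False
  with assms obtain a b where "a \<in> A" "b \<in> A" "b \<noteq> 0" "x = to_fract a / to_fract b"
    unfolding quotients_def by blast
  moreover from this False have "a \<noteq> 0" "inverse x = to_fract b / to_fract a" by auto
  ultimately show ?thesis unfolding quotients_def by blast
qed (use assms in simp)

text \<open>
  The generator \<open>u\<close> is the constant coefficient \<open>g(x, 0)\<close> of the monic generator \<open>g\<close> of the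
  ideal \<open>J\<close>. Everything rests on the fact that the coefficients of \<open>g\<close> are at once
  quotients of elements of the diagonal ring \<open>A\<close> (they come out of a division over the fraction field
  of \<open>A\<close>) and polynomials (by Gauss's lemma), so that they belong to \<open>A\<close>. The divisibility
  of \<open>a - a(0)\<close> by \<open>u\<close> for all \<open>a\<close> in \<open>A\<close> then drives an induction on the degree of \<open>a\<close>.
\<close>

lemma lueroth_two_polynomials:
  fixes h1 h2 :: "'a::field poly"
  assumes monic: "lead_coeff h1 = 1" and deg: "degree h1 > 0"
  defines "J \<equiv> ideal2 (fract_poly (Delta h1)) (fract_poly (Delta h2))"
  shows "\<exists>u a1 a2. h1 = a1 \<circ>\<^sub>p u \<and> h2 = a2 \<circ>\<^sub>p u \<and> coeff u 0 = 0 \<and> fract_poly (Delta u) \<in> J"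
proof -
  define A where "A = diagonal_ring J"
  note A_const = diagonal_ring_const[of _ "fract_poly (Delta h1)" "fract_poly (Delta h2)", folded J_def, folded A_def]
  note A_diff = diagonal_ring_diff[of _ "fract_poly (Delta h1)" "fract_poly (Delta h2)", folded J_def, folded A_def]
  note A_mult = diagonal_ring_mult[of _ "fract_poly (Delta h1)" "fract_poly (Delta h2)", folded J_def, folded A_def]
  note A_cancel = diagonal_ring_cancel[of _ "fract_poly (Delta h1)" "fract_poly (Delta h2)", folded J_def, folded A_def]
  have A1: "1 \<in> A" using A_const[of 1] by (simp flip: one_pCons)
  have hA: "h1 \<in> A" "h2 \<in> A" by (simp_all add: A_def J_def diagonal_ring_def ideal2_gens)
  define K where "K = quotients A"
  let ?S = "{fract_poly (Delta h1), fract_poly (Delta h2)}"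
  have coeff_K: "coeff (fract_poly (Delta h)) i \<in> K" if "h \<in> A" for h i
  proof -
    have "[:coeff h i:] - (if i = 0 then h else 0) \<in> A"
      using that A_const A_diff A_const[of 0] by auto
    from quotients_base[OF this A1] show ?thesis
      by (simp add: K_def coeff_map_poly coeff_Delta split: if_splits)
  qed
  have "Delta h1 \<noteq> 0" using deg degree_Delta[of h1] by (metis degree_0 less_irrefl)
  hence h1_nz: "fract_poly (Delta h1) \<noteq> 0" by simp
  have S_coeff: "coeff p i \<in> K" if "p \<in> ?S" for p i
    using that coeff_K hA by blast
  have K_diff: "x - y \<in> K" if "x \<in> K" "y \<in> K" for x y
    using quotients_diff[OF A_mult A_diff] that unfolding K_def by blast
  have K_mult: "x * y \<in> K" if "x \<in> K" "y \<in> K" for x y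
    using quotients_mult[OF A_mult] that unfolding K_def by blast
  have K_inverse: "inverse x \<in> K" if "x \<in> K" for x
    using quotients_inverse that unfolding K_def by blast
  obtain g where g: "g \<in> coeff_span K ?S" "lead_coeff g = 1" "\<forall>p\<in>coeff_span K ?S. g dvd p"
    using coeff_span_generator[OF insertI1 h1_nz S_coeff K_diff K_mult K_inverse] by blast
  have g_coeff: "coeff g i \<in> K" for i
    using coeff_span_coeff[OF g(1) S_coeff K_diff K_mult] .
  have gJ: "g \<in> J"
    using g(1) unfolding J_def
    by (induction) (auto intro: ideal2_gens ideal2_diff ideal2_mult)
  have g_dvd: "g dvd fract_poly (Delta h1)" "g dvd fract_poly (Delta h2)"
    using g(3) coeff_span.base by blast+
  have lD: "lead_coeff (Delta h1) = 1" using deg monic by (simp add: coeff_Delta flip: one_pCons)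
  obtain G where G: "g = fract_poly G" "lead_coeff G = 1"
    using monic_factor_fract_poly[OF g_dvd(1) lD g(2)] by blast
  have A_dvd: "G dvd Delta a" if "a \<in> A" for a
    using that G monic_fract_poly_dvdD[of G "Delta a"] ideal2_dvd[OF _ g_dvd]
    by (simp add: A_def diagonal_ring_def J_def)
  define u where "u = coeff G 0"
  have "u \<in> A"
  proof -
    have "to_fract u \<in> K" using g_coeff[of 0] by (simp add: G u_def coeff_map_poly)
    then obtain a b where ab: "a \<in> A" "b \<in> A" "b \<noteq> 0" "to_fract u = to_fract a / to_fract b"
      unfolding K_def quotients_def by blast
    hence "to_fract (b * u) = to_fract a" by simp
    hence "b * u = a" by (simp only: to_fract_eq_iff)
    thus ?thesis using A_cancel ab by blast
  qed
  \<comment> \<open>Put \<open>y = 0\<close> in \<open>a(y) - a(x) = G(x, y) q(x, y)\<close>.\<close>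
  have u_dvd: "u dvd a - [:coeff a 0:]" if "a \<in> A" for a
  proof -
    obtain q where "Delta a = G * q" using A_dvd[OF \<open>a \<in> A\<close>] by (elim dvdE)
    hence "coeff (Delta a) 0 = u * coeff q 0" by (simp add: u_def coeff_mult)
    hence "a - [:coeff a 0:] = u * (- coeff q 0)" by (simp add: coeff_Delta algebra_simps)
    thus ?thesis by (rule dvdI)
  qed
  have u0: "u \<noteq> 0"
  proof
    assume "u = 0"
    hence "h1 = [:coeff h1 0:]" using u_dvd[OF hA(1)] by simp
    thus False using deg by (metis degree_pCons_0 less_irrefl)
  qed
  \<comment> \<open>As \<open>y - x\<close> divides \<open>G\<close>, the value \<open>u(0) = G(0, 0)\<close> vanishes; so \<open>u\<close> is not constant.\<close>
  have uc0: "coeff u 0 = 0"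
  proof -
    have X: "fract_poly [:-[:0, 1:], 1:] dvd fract_poly (Delta p)" for p :: "'a poly"
      unfolding Delta_eq_divided_difference by (intro fract_poly_dvd dvd_triv_left)
    have "fract_poly [:-[:0, 1:], 1:] dvd g"
      by (rule ideal2_dvd[OF gJ[unfolded J_def] X X])
    hence "[:-[:0, 1:], 1:] dvd G"
      unfolding G(1) by (rule monic_fract_poly_dvdD[rotated]) simp
    then obtain q where "G = [:-[:0, 1:], 1:] * q" by (elim dvdE)
    hence "u = - [:0, 1:] * coeff q 0" by (simp add: u_def coeff_mult)
    thus ?thesis by (simp add: coeff_mult)
  qed
  have gen: "\<exists>b. a = b \<circ>\<^sub>p u" if "a \<in> A" for a
    using that
  proof (induction "degree a" arbitrary: a rule: less_induct)
    case less
    show ?case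
    proof (cases "degree a = 0")
      case True
      then obtain c where "a = [:c:]" by (rule degree_eq_zeroE)
      hence "a = [:c:] \<circ>\<^sub>p u" by simp
      thus ?thesis by blast
    next
      case False
      obtain s where s: "a - [:coeff a 0:] = u * s" using u_dvd[OF less.prems] by (elim dvdE)
      have us: "u * s \<in> A" using s A_diff[OF less.prems A_const[of "coeff a 0"]] by simp
      hence "s \<in> A" using A_cancel \<open>u \<in> A\<close> u0 by blast
      have "degree u > 0"
      proof (rule ccontr)
        assume "\<not> degree u > 0"
        then obtain c where "u = [:c:]" by (auto elim: degree_eq_zeroE)
        thus False using u0 uc0 by simp
      qed
      have "a = [:coeff a 0:] + u * s" using s by (simp add: algebra_simps)
      have "s \<noteq> 0" using \<open>a = _\<close> False by (metis add.right_neutral degree_pCons_0 mult_zero_right)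
      have "degree (u * s) \<le> degree a" unfolding s[symmetric] by (rule degree_diff_le) auto
      hence "degree s < degree a"
        using \<open>degree u > 0\<close> \<open>s \<noteq> 0\<close> u0 by (simp add: degree_mult_eq)
      then obtain b where "s = b \<circ>\<^sub>p u" using less.hyps \<open>s \<in> A\<close> by blast
      hence "a = pCons (coeff a 0) b \<circ>\<^sub>p u" using \<open>a = _\<close> by (simp add: pcompose_pCons)
      thus ?thesis by blast
    qed
  qed
  have "fract_poly (Delta u) \<in> J" using \<open>u \<in> A\<close> by (simp add: A_def diagonal_ring_def)
  thus ?thesis using gen hA uc0 by blast
qed

section \<open>Counting minimal decompositions\<close>

text \<open>
  Indecomposability forces the outer factor \<open>a\<close> to be linear, and normality then determines both of
  its coefficients.
\<close>

lemma indecomposable_left_factor: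
  fixes h :: "'a::field poly"
  assumes "normal_poly h" "\<not> decomposable h" "h = a \<circ>\<^sub>p u" "coeff u 0 = 0" "degree u \<ge> 2" 
  shows "h = smult (inverse (lead_coeff u)) u"
proof -
  have "degree a \<le> 1" 
  proof (rule ccontr)
    assume "\<not> degree a \<le> 1"
    hence "is_decomposition h (a, u)" using assms(3,5) by (simp add: is_decomposition_def)
    thus False using assms(2) unfolding decomposable_def by blast
  qed
  then obtain c0 c1 where a: "a = [:c0, c1:]"
    by (cases a; cases "degree a") (auto split: if_splits elim!: degree_eq_zeroE)
  have h: "h = [:c0:] + smult c1 u" using assms(3) by (simp add: a pcompose_pCons mult.commute)
  have "c0 = 0" using assms(1,4) by (simp add: normal_poly_def h)
  hence "h = smult c1 u" using h by simp
  moreover from this have "c1 * lead_coeff u = 1"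
    using assms(1) by (cases "c1 = 0") (auto simp: normal_poly_def)
  hence "c1 = inverse (lead_coeff u)" by (metis inverse_unique mult.commute)
  ultimately show ?thesis by simp
qed

text \<open>
  The common inner polynomial \<open>u\<close> of \<open>h1\<close> and \<open>h2\<close> cannot have degree two or more, as its normal
  associate would then be equal to both. So \<open>Delta u\<close> is a constant multiple of \<open>y - x\<close>, and its
  representation by \<open>Delta h1\<close> and \<open>Delta h2\<close> can be divided by \<open>y - x\<close>.
\<close>

lemma divided_differences_comaximal:
  fixes h1 h2 :: "'a::field poly"
  assumes h1: "normal_poly h1" "\<not> decomposable h1" "degree h1 \<ge> 2"
    and h2: "normal_poly h2" "\<not> decomposable h2" "degree h2 \<ge> 2"
    and "h1 \<noteq> h2"
  shows "1 \<in> ideal2 (fract_poly (divided_difference h1)) (fract_poly (divided_difference h2))"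
proof -
  obtain u a1 a2 where u: "h1 = a1 \<circ>\<^sub>p u" "h2 = a2 \<circ>\<^sub>p u" "coeff u 0 = 0"
    and J: "fract_poly (Delta u) \<in> ideal2 (fract_poly (Delta h1)) (fract_poly (Delta h2))"
    using lueroth_two_polynomials[of h1 h2] h1 by (auto simp: normal_poly_def)
  have "\<not> degree u \<ge> 2"
    using indecomposable_left_factor[of h1 a1 u] indecomposable_left_factor[of h2 a2 u] assms u by auto
  moreover have "degree u \<noteq> 0" using h1(3) u(1) by (intro notI) (simp add: degree_pcompose)
  ultimately have "degree u = 1" by simp
  then obtain b c where "u = [:b, c:]" "c \<noteq> 0" by (rule degree1_coeffs)
  with u(3) have uc: "u = [:0, c:]" "c \<noteq> 0" by simp_all
  let ?X = "fract_poly [:-[:0, 1:], 1:] :: 'a poly fract poly"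
  have "Delta u = smult [:c:] [:-[:0, 1:], 1:]" by (simp add: uc Delta_def map_poly_pCons)
  hence D: "fract_poly (Delta u) = smult (to_fract [:c:]) ?X" by (simp only: fract_poly_smult)
  obtain \<alpha> \<beta> where eq: "fract_poly (Delta u) = \<alpha> * fract_poly (Delta h1) + \<beta> * fract_poly (Delta h2)"
    using J unfolding ideal2_def by blast
  have "?X * [:to_fract [:c:]:] = ?X * (\<alpha> * fract_poly (divided_difference h1) + \<beta> * fract_poly (divided_difference h2))"
    using eq[unfolded D] unfolding Delta_eq_divided_difference fract_poly_mult
    by (simp add: algebra_simps)
  moreover have "?X \<noteq> 0" by (simp only: fract_poly_eq_0_iff) simp
  ultimately have "[:to_fract [:c:]:] = \<alpha> * fract_poly (divided_difference h1) + \<beta> * fract_poly (divided_difference h2)"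
    by (simp only: mult_cancel_left) simp
  hence "[:to_fract [:c:]:] \<in> ideal2 (fract_poly (divided_difference h1)) (fract_poly (divided_difference h2))"
    unfolding ideal2_def by blast
  hence "smult (inverse (to_fract [:c:])) [:to_fract [:c:]:]
      \<in> ideal2 (fract_poly (divided_difference h1)) (fract_poly (divided_difference h2))"
    by (rule ideal2_smult)
  moreover have "to_fract [:c:] \<noteq> 0" using uc(2) by simp
  hence "smult (inverse (to_fract [:c:])) [:to_fract [:c:]:] = 1" by (simp add: one_pCons)
  ultimately show ?thesis by simp
qed

text \<open>
  Comaximality is expressed by \<open>1 \<in> ideal2 a b\<close>. The two identities are multiplied, and the product
  is expanded modulo \<open>a\<close>.
\<close>

lemma comaximal_mult:
  assumes "1 \<in> ideal2 a b" "1 \<in> ideal2 a c"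
  shows "1 \<in> ideal2 a (b * c)"
proof -
  obtain \<alpha> \<beta> \<gamma> \<delta> where 1: "1 = \<alpha> * a + \<beta> * b" "1 = \<gamma> * a + \<delta> * c"
    using assms unfolding ideal2_def by blast
  have "1 = (\<alpha> * a + \<beta> * b) * (\<gamma> * a + \<delta> * c)" by (simp flip: 1)
  also have "\<dots> = (\<alpha> * \<gamma> * a + \<alpha> * \<delta> * c + \<beta> * b * \<gamma>) * a + (\<beta> * \<delta>) * (b * c)"
    by (simp add: algebra_simps)
  finally show ?thesis unfolding ideal2_def by blast
qed

lemma comaximal_prod:
  assumes "finite S" "\<And>i. i \<in> S \<Longrightarrow> 1 \<in> ideal2 a (f i)"
  shows "1 \<in> ideal2 a (prod f S)"
  using assms by (induction) (auto intro: comaximal_mult ideal2_gens)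

lemma comaximal_dvd_mult:
  assumes "1 \<in> ideal2 a b" "a dvd n" "b dvd n"
  shows "a * b dvd n"
proof -
  obtain \<alpha> \<beta> where 1: "1 = \<alpha> * a + \<beta> * b" using assms(1) unfolding ideal2_def by blast
  have "n = (\<alpha> * a + \<beta> * b) * n" by (simp flip: 1)
  hence "n = \<alpha> * (a * n) + \<beta> * (n * b)" by (simp add: algebra_simps)
  thus ?thesis by (metis assms(2,3) dvd_add dvd_mult dvd_refl mult_dvd_mono)
qed

lemma comaximal_prod_dvd:
  assumes "finite S" "\<And>i. i \<in> S \<Longrightarrow> f i dvd n"
    and "\<And>i j. i \<in> S \<Longrightarrow> j \<in> S \<Longrightarrow> i \<noteq> j \<Longrightarrow> 1 \<in> ideal2 (f i) (f j)"
  shows "prod f S dvd n"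
  using assms
proof (induction)
  case (insert i S)
  have "1 \<in> ideal2 (f i) (prod f S)" using insert by (intro comaximal_prod) auto
  thus ?case using insert by (simp add: comaximal_dvd_mult)
qed simp

text \<open>
  The pairwise comaximal divisors \<open>\<phi>(h)\<close> of \<open>\<phi>(f)\<close> have a product that divides \<open>\<phi>(f)\<close>, and the
  degree of \<open>\<phi>(p)\<close> is \<open>deg p - 1\<close>.
\<close>

lemma sum_degrees_right_components_le:
  fixes f :: "'a::field poly"
  assumes "finite S" "degree f \<ge> 2"
    and S: "\<And>h. h \<in> S \<Longrightarrow> normal_poly h \<and> \<not> decomposable h \<and> degree h \<ge> 2 \<and> (\<exists>g. f = g \<circ>\<^sub>p h)"
  shows "(\<Sum>h\<in>S. degree h - 1) \<le> degree f - 1"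
proof -
  let ?\<phi> = "\<lambda>p. fract_poly (divided_difference p) :: 'a poly fract poly"
  have deg: "degree (?\<phi> p) = degree p - 1" for p by (simp add: degree_divided_difference)
  have nz: "?\<phi> p \<noteq> 0" if "degree p \<ge> 2" for p using deg[of p] that by (intro notI) simp
  have "?\<phi> h dvd ?\<phi> f" if "h \<in> S" for h
    using S[OF that] divided_difference_pcompose_dvd[of h] fract_poly_dvd by blast
  moreover have "1 \<in> ideal2 (?\<phi> h1) (?\<phi> h2)" if "h1 \<in> S" "h2 \<in> S" "h1 \<noteq> h2" for h1 h2
    using S[OF that(1)] S[OF that(2)] that(3) by (intro divided_differences_comaximal) auto
  ultimately have "prod ?\<phi> S dvd ?\<phi> f" using assms(1) by (intro comaximal_prod_dvd) auto
  hence "degree (prod ?\<phi> S) \<le> degree (?\<phi> f)" using nz[OF assms(2)] by (rule dvd_imp_degree_le)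
  moreover have "degree (prod ?\<phi> S) = (\<Sum>h\<in>S. degree (?\<phi> h))"
    using S nz by (intro degree_prod_sum_eq) auto
  ultimately show ?thesis by (simp only: deg)
qed

text \<open>
  The bound on finite subsets also yields finiteness, since \<open>e - 1 \<ge> 1\<close> bounds their cardinality by
  \<open>deg f - 1\<close>. The passage to right components loses nothing: \<open>g\<close> is determined by \<open>g \<circ> h\<close> and \<open>h\<close>
  as \<open>h\<close> is not constant.
\<close>

lemma card_minimal_decompositions_bound:
  fixes f :: "'a::field poly"
  assumes M: "M \<subseteq> minimal_decompositions f" and "e \<ge> 2"
    and e: "\<forall>z\<in>M. e \<le> degree (snd z)"
    and f: "degree f \<ge> 2"
  shows "finite M \<and> real (card M) \<le> (real (degree f) - 1) / (real e - 1)"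
proof -
  have mem: "normal_poly (snd z) \<and> \<not> decomposable (snd z) \<and> degree (snd z) \<ge> 2 \<and> f = fst z \<circ>\<^sub>p snd z"
    if "z \<in> M" for z
  proof -
    have "z \<in> minimal_decompositions f" using that M by blast
    thus ?thesis by (simp add: minimal_decompositions_def is_decomposition_def case_prod_unfold)
  qed
  have inj: "inj_on snd M"
  proof (rule inj_onI)
    fix z w assume zw: "z \<in> M" "w \<in> M" "snd z = snd w"
    have "fst z \<circ>\<^sub>p snd z = fst w \<circ>\<^sub>p snd z"
      using mem[OF zw(1)] mem[OF zw(2)] zw(3) by metis
    hence "(fst z - fst w) \<circ>\<^sub>p snd z = 0" unfolding pcompose_diff by simp
    moreover have "degree (snd z) > 0" using mem[OF zw(1)] by linarith
    ultimately have "fst z - fst w = 0" by (rule pcompose_eq_0)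
    thus "z = w" using zw(3) by (simp add: prod_eq_iff)
  qed
  have bound: "card T * (e - 1) \<le> degree f - 1" if "finite T" "T \<subseteq> M" for T
  proof -
    have "card T * (e - 1) = card (snd ` T) * (e - 1)"
      using card_image inj inj_on_subset that(2) by metis
    also have "\<dots> \<le> (\<Sum>h\<in>snd ` T. degree h - 1)"
    proof -
      have "(\<Sum>h\<in>snd ` T. e - 1) \<le> (\<Sum>h\<in>snd ` T. degree h - 1)"
        using that(2) e by (intro sum_mono diff_le_mono) auto
      thus ?thesis by simp
    qed
    also have "\<dots> \<le> degree f - 1"
      using that mem f by (intro sum_degrees_right_components_le) blast+
    finally show ?thesis .
  qed
  have "card T \<le> degree f - 1" if "T \<subseteq> M" "finite T" for T
  proof -
    have "card T * 1 \<le> card T * (e - 1)" using \<open>e \<ge> 2\<close> by (intro mult_le_mono) auto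
    thus ?thesis using bound[OF that(2,1)] by linarith
  qed
  hence fin: "finite M" using finite_if_finite_subsets_card_bdd[of M] by blast
  have "real (card M) * (real e - 1) = real (card M * (e - 1))" using \<open>e \<ge> 2\<close> by (simp add: of_nat_diff)
  also have "\<dots> \<le> real (degree f - 1)" using bound[OF fin subset_refl] by (intro of_nat_mono)
  also have "\<dots> = real (degree f) - 1" using f by (simp add: of_nat_diff)
  finally show ?thesis using fin \<open>e \<ge> 2\<close> by (simp add: pos_le_divide_eq)
qed

theorem corollary3p26:
  fixes f :: "'a::field poly" and n :: nat
  assumes "decomposable f"
    and "degree f = n"
    and "pderiv f \<noteq> 0"
  shows "(\<forall>d::nat. d \<ge> 2 \<and> d dvd n \<longrightarrow>
            finite {(g, h) \<in> minimal_decompositions f. degree h = d} \<and>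
            real (card {(g, h) \<in> minimal_decompositions f. degree h = d})
              \<le> (real n - 1) / (real d - 1))
       \<and> (\<forall>q::nat. prime q \<and> q dvd n \<and> (\<forall>p::nat. prime p \<and> p dvd n \<longrightarrow> q \<le> p) \<longrightarrow>
            finite (minimal_decompositions f) \<and>
            real (card (minimal_decompositions f)) \<le> (real n - 1) / (real q - 1))"
proof -
  obtain g h where gh: "degree g \<ge> 2" "degree h \<ge> 2" "f = g \<circ>\<^sub>p h"
    using assms(1) by (auto simp: decomposable_def is_decomposition_def)
  have "2 * 2 \<le> degree g * degree h" using gh by (intro mult_le_mono)
  hence n: "degree f \<ge> 2" by (simp add: gh degree_pcompose)
  have least: "q \<le> degree h"
    if q: "\<forall>p::nat. prime p \<and> p dvd n \<longrightarrow> q \<le> p"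
      and z: "(g, h) \<in> minimal_decompositions f" for q g h
  proof -
    have h: "degree h \<ge> 2" "f = g \<circ>\<^sub>p h"
      using z by (simp_all add: minimal_decompositions_def is_decomposition_def)
    have "n = degree g * degree h" using assms(2) h(2) degree_pcompose by metis
    obtain p where p: "prime p" "p dvd degree h"
      using prime_factor_nat[of "degree h"] h(1) by auto
    hence "p dvd n" using \<open>n = _\<close> by simp
    hence "q \<le> p" using q p(1) by blast
    also have "p \<le> degree h" using p(2) h(1) by (intro dvd_imp_le) auto
    finally show ?thesis .
  qed
  show ?thesis
  proof (intro conjI[where P = "\<forall>d. _ d"] allI impI)
    fix d :: nat
    assume d: "d \<ge> 2 \<and> d dvd n"
    let ?M = "{(g, h) \<in> minimal_decompositions f. degree h = d}"
    have "?M \<subseteq> minimal_decompositions f" "\<forall>z\<in>?M. d \<le> degree (snd z)" by auto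
    from card_minimal_decompositions_bound[OF this(1) _ this(2) n] d
    show "finite ?M \<and> real (card ?M) \<le> (real n - 1) / (real d - 1)" by (simp add: assms(2))
  next
    fix q :: nat
    assume q: "prime q \<and> q dvd n \<and> (\<forall>p::nat. prime p \<and> p dvd n \<longrightarrow> q \<le> p)"
    have "q \<ge> 2" using q prime_ge_2_nat by blast
    moreover have "\<forall>z\<in>minimal_decompositions f. q \<le> degree (snd z)"
      using least q by force
    ultimately show "finite (minimal_decompositions f) \<and>
        real (card (minimal_decompositions f)) \<le> (real n - 1) / (real q - 1)"
      using card_minimal_decompositions_bound[OF subset_refl _ _ n] assms(2) by blast
  qed
qed

end
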